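(* Let $X$ be a complex Banach space and let $J \subset X$ be an $M$-ideal. Let $x \in X$ be a unit vector such that $d(x,J)<1$. Then $$\partial_x = \overline{CO}\{f \in \partial_e J^*_1 : f(x)=1\},$$ where the closure is taken in the weak$^*$-topology of $X^*$. Consequently, for every $y \in X$, $$\lim_{t\to 0^+} \frac{\|x+ty\|-\|x\|}{t} = \sup\{\mathrm{Re}\, f(y) : f \in \partial_e J^*_1,\ f(x)=1\}.$$
   Context: For a vector $x$ in a Banach space $X$, $\partial_x=\{f\in X^*: \|f\|=1,\ f(x)=\|x\|\}$ is the subdifferential set of the norm at $x$. For a Banach space $E$, $E_1$ is its closed unit ball, and $\partial_e C$ denotes the set of extreme points of a convex set $C$; thus $\partial_e J^*_1$ is the set of extreme points of the closed unit ball of $J^*$. $CO$ denotes convex hull, and the bar denotes closure. $d(x,J)=\inf_{j\in J}\|x-j\|$. A closed subspace $J\subset X$ is an $M$-ideal if there is a linear projection $P:X^*\to X^*$ with $\ker P=J^\perp$ (the annihilator of $J$ in $X^*$) and $\|x^*\|=\|P(x^* )\|+\|x^*-P(x^* )\|$ for all $x^*\in X^*$. In this case each functional in $J^*$ has a unique norm-preserving extension to $X$, and $J^*$ is identified with the range of $P$, so that $X^*=J^*\oplus_1 J^\perp$; through this identification elements of $J^*$ are regarded as functionals on $X$. *)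

theory Defs
  imports "HOL-Analysis.Analysis"
begin

class complex_normed_vector = real_normed_vector +
  fixes scaleC :: "complex \<Rightarrow> 'a \<Rightarrow> 'a"  (infixr \<open>*\<^sub>C\<close> 75)
  assumes scaleC_add_right: "c *\<^sub>C (x + y) = c *\<^sub>C x + c *\<^sub>C y"
    and scaleC_add_left: "(c + d) *\<^sub>C x = c *\<^sub>C x + d *\<^sub>C x"
    and scaleC_scaleC: "c *\<^sub>C (d *\<^sub>C x) = (c * d) *\<^sub>C x"
    and scaleC_of_real: "complex_of_real r *\<^sub>C x = r *\<^sub>R x"
    and norm_scaleC: "norm (c *\<^sub>C x) = cmod c * norm x"

class cbanach = complex_normed_vector + banach

definition csubspace :: "'a::complex_normed_vector set \<Rightarrow> bool" where
  "csubspace J \<longleftrightarrow>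
     0 \<in> J \<and> (\<forall>x\<in>J. \<forall>y\<in>J. x + y \<in> J) \<and> (\<forall>c. \<forall>x\<in>J. c *\<^sub>C x \<in> J)"

(* The complex dual is the set of complex-linear elements of the real Banach space of bounded
   real-linear maps into the complex numbers; the norm of that space restricts to the dual norm. *)
definition cdual :: "('a::complex_normed_vector \<Rightarrow>\<^sub>L complex) set" where
  "cdual = {f. \<forall>c x. blinfun_apply f (c *\<^sub>C x) = c * blinfun_apply f x}"

definition cdual_scale ::
    "complex \<Rightarrow> ('a::complex_normed_vector \<Rightarrow>\<^sub>L complex) \<Rightarrow> ('a \<Rightarrow>\<^sub>L complex)" where
  "cdual_scale c f = blinfun_mult_right c o\<^sub>L f"

(* For scalar-valued maps the strong operator topology is that of pointwise convergence. *)
definition weak_star_topology :: "('a::complex_normed_vector \<Rightarrow>\<^sub>L complex) topology" where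
  "weak_star_topology = subtopology strong_operator_topology cdual"

definition norm_subdiff :: "'a::complex_normed_vector \<Rightarrow> ('a \<Rightarrow>\<^sub>L complex) set" where
  "norm_subdiff x =
     {f \<in> cdual. norm f = 1 \<and> blinfun_apply f x = complex_of_real (norm x)}"

definition annihilator :: "'a::complex_normed_vector set \<Rightarrow> ('a \<Rightarrow>\<^sub>L complex) set" where
  "annihilator J = {f \<in> cdual. \<forall>j\<in>J. blinfun_apply f j = 0}"

(* Only the restriction of P to the dual is constrained. *)
definition M_ideal_projection ::
    "'a::complex_normed_vector set \<Rightarrow> (('a \<Rightarrow>\<^sub>L complex) \<Rightarrow> ('a \<Rightarrow>\<^sub>L complex)) \<Rightarrow> bool" where
  "M_ideal_projection J P \<longleftrightarrow>
     (\<forall>f\<in>cdual. P f \<in> cdual) \<and>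
     (\<forall>f\<in>cdual. \<forall>g\<in>cdual. P (f + g) = P f + P g) \<and>
     (\<forall>c. \<forall>f\<in>cdual. P (cdual_scale c f) = cdual_scale c (P f)) \<and>
     (\<forall>f\<in>cdual. P (P f) = P f) \<and>
     {f \<in> cdual. P f = 0} = annihilator J \<and>
     (\<forall>f\<in>cdual. norm f = norm (P f) + norm (f - P f))"

definition M_ideal :: "'a::complex_normed_vector set \<Rightarrow> bool" where
  "M_ideal J \<longleftrightarrow> csubspace J \<and> closed J \<and> (\<exists>P. M_ideal_projection J P)"

(* For an M-ideal J with projection P, the dual of J is identified with the range P ` cdual:
   a functional on J corresponds to its unique norm-preserving extension. *)
definition J_dual_ball ::
    "(('a::complex_normed_vector \<Rightarrow>\<^sub>L complex) \<Rightarrow> ('a \<Rightarrow>\<^sub>L complex)) \<Rightarrow> ('a \<Rightarrow>\<^sub>L complex) set" where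
  "J_dual_ball P = {f \<in> P ` cdual. norm f \<le> 1}"

end

theory Submission
  imports Defs
begin

text \<open>
  A functional \<open>f\<close> norming \<open>x\<close> splits as \<open>P f + (f - P f)\<close> with norms adding up to \<open>1\<close>, and the
  component in \<open>annihilator J\<close> is at most \<open>infdist x J < 1\<close> times its norm at \<open>x\<close>; so it vanishes.
  Hence the subdifferential of \<open>x\<close> is a weak-star compact face of the dual ball of \<open>J\<close>, its extreme
  points are extreme in that ball, and the first claim is the Krein--Milman theorem. The directional
  derivative at \<open>x\<close> is a sublinear functional of the direction \<open>y\<close>; by the Hahn--Banach theorem its
  value at \<open>y\<close> is attained by some element of the subdifferential, hence also by an extreme point.
\<close>

section \<open>Sublinear functionals and the Hahn--Banach theorem\<close>

definition sublinear :: "('a::real_vector \<Rightarrow> real) \<Rightarrow> bool" where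
  "sublinear p \<longleftrightarrow> (\<forall>x y. p (x + y) \<le> p x + p y) \<and> (\<forall>r\<ge>0. \<forall>x. p (r *\<^sub>R x) = r * p x)"

lemma sublinear_add: "sublinear p \<Longrightarrow> p (x + y) \<le> p x + p y"
  by (simp add: sublinear_def)

lemma sublinear_scale: "sublinear p \<Longrightarrow> r \<ge> 0 \<Longrightarrow> p (r *\<^sub>R x) = r * p x"
  by (simp add: sublinear_def)

lemma sublinear_zero: "sublinear p \<Longrightarrow> p 0 = 0"
  using sublinear_scale[of p 0 0] by simp

lemma sublinear_minus: "sublinear p \<Longrightarrow> - p (- x) \<le> p x"
  using sublinear_add[of p x "- x"] sublinear_zero[of p] by simp

lemma sublinear_norm: "sublinear norm"
  by (auto simp: sublinear_def norm_triangle_ineq)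

text \<open>Applying \<open>le\<close> to the inverse factor at \<open>r *\<^sub>R x\<close> gives
  the reverse inequality, so one direction of homogeneity is enough.\<close>

lemma sublinearI:
  assumes "\<And>x y. p (x + y) \<le> p x + p y"
    and "p 0 = 0"
    and le: "\<And>r x. r > 0 \<Longrightarrow> p (r *\<^sub>R x) \<le> r * p x"
  shows "sublinear p"
proof -
  have "p (r *\<^sub>R x) = r * p x" if "r \<ge> 0" for r x
  proof (cases "r = 0")
    case False
    then have r: "r > 0" using that by simp
    have "p x \<le> inverse r * p (r *\<^sub>R x)"
      using le[of "inverse r" "r *\<^sub>R x"] r by simp
    then have "r * p x \<le> p (r *\<^sub>R x)"
      using r by (simp add: field_simps)
    then show ?thesis using le[OF r, of x] by simp
  qed (simp add: assms(2))
  then show ?thesis using assms(1) by (simp add: sublinear_def)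
qed

text \<open>The infimum over \<open>t \<ge> 0\<close> is the limit as \<open>t \<rightarrow> \<infinity>\<close>, so \<open>sub_shift p y\<close> is the one-sided
  derivative of \<open>p\<close> at \<open>y\<close>. It is again sublinear, lies below \<open>p\<close>, and is linear along \<open>y\<close>; thus a
  minimal sublinear functional is linear, which drives the proof of the Hahn--Banach theorem.\<close>

definition sub_shift :: "('a::real_vector \<Rightarrow> real) \<Rightarrow> 'a \<Rightarrow> 'a \<Rightarrow> real" where
  "sub_shift p y x = (INF t\<in>{0..}. p (x + t *\<^sub>R y) - t * p y)"

text \<open>A lower bound free of \<open>t\<close>: the infimum in \<open>sub_shift\<close> is
  finite, and the rules for conditionally complete orders apply to it.\<close>

lemma sub_shift_bound:
  assumes "sublinear p" "t \<ge> 0"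
  shows "- p (- x) \<le> p (x + t *\<^sub>R y) - t * p y"
proof -
  have "t * p y = p ((x + t *\<^sub>R y) + - x)"
    using sublinear_scale[OF assms] by simp
  then show ?thesis
    using sublinear_add[OF assms(1), of "x + t *\<^sub>R y" "- x"] by simp
qed

lemma sub_shift_le:
  assumes "sublinear p" "t \<ge> 0"
  shows "sub_shift p y x \<le> p (x + t *\<^sub>R y) - t * p y"
  unfolding sub_shift_def
proof (rule cINF_lower)
  show "bdd_below ((\<lambda>t. p (x + t *\<^sub>R y) - t * p y) ` {0..})"
    using sub_shift_bound[OF assms(1)] by (intro bdd_belowI2[where m = "- p (- x)"]) auto
qed (use assms in auto)

lemma sub_shift_greatest:
  "(\<And>t. t \<ge> 0 \<Longrightarrow> b \<le> p (x + t *\<^sub>R y) - t * p y) \<Longrightarrow> b \<le> sub_shift p y x"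
  unfolding sub_shift_def by (rule cINF_greatest) auto

lemma sub_shift_le_self: "sublinear p \<Longrightarrow> sub_shift p y x \<le> p x"
  using sub_shift_le[of p 0 y x] by simp

text \<open>For \<open>t = 1\<close> the argument of \<open>p\<close> cancels. Hence a linear
  functional below \<open>sub_shift p y\<close> is at least \<open>p y\<close> at
  \<open>y\<close>.\<close>

lemma sub_shift_minus: "sublinear p \<Longrightarrow> sub_shift p y (- y) \<le> - p y"
  using sub_shift_le[of p 1 y "- y"] by (simp add: sublinear_zero)

text \<open>Parameters \<open>s\<close> and \<open>t\<close> for two summands combine to the
  admissible parameter \<open>s + t\<close>, after which the infima are taken one at a time. Scaling
  the argument by \<open>r\<close> amounts to replacing \<open>t\<close> by
  \<open>r * t\<close>.\<close>

lemma sublinear_sub_shift: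
  assumes p: "sublinear p"
  shows "sublinear (sub_shift p y)"
proof (rule sublinearI)
  show "sub_shift p y 0 = 0"
  proof (rule antisym)
    show "sub_shift p y 0 \<le> 0"
      using sub_shift_le_self[OF p, of y 0] sublinear_zero[OF p] by simp
    show "0 \<le> sub_shift p y 0"
      by (rule sub_shift_greatest) (simp add: sublinear_scale[OF p])
  qed
next
  fix x z
  have *: "sub_shift p y (x + z) \<le> (p (x + s *\<^sub>R y) - s * p y) + (p (z + t *\<^sub>R y) - t * p y)"
    if "s \<ge> 0" "t \<ge> 0" for s t
  proof -
    have "sub_shift p y (x + z) \<le> p ((x + z) + (s + t) *\<^sub>R y) - (s + t) * p y"
      by (rule sub_shift_le[OF p]) (use that in simp)
    also have "(x + z) + (s + t) *\<^sub>R y = (x + s *\<^sub>R y) + (z + t *\<^sub>R y)"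
      by (simp add: algebra_simps)
    finally show ?thesis
      using sublinear_add[OF p, of "x + s *\<^sub>R y" "z + t *\<^sub>R y"] by (simp add: algebra_simps)
  qed
  have "sub_shift p y (x + z) - (p (x + s *\<^sub>R y) - s * p y) \<le> sub_shift p y z" if "s \<ge> 0" for s
    by (rule sub_shift_greatest) (use *[OF that] in \<open>force simp: algebra_simps\<close>)
  then have "sub_shift p y (x + z) - sub_shift p y z \<le> sub_shift p y x"
    by (intro sub_shift_greatest) (force simp: algebra_simps)
  then show "sub_shift p y (x + z) \<le> sub_shift p y x + sub_shift p y z" by simp
next
  fix r :: real and x
  assume r: "r > 0"
  have "inverse r * sub_shift p y (r *\<^sub>R x) \<le> sub_shift p y x"
  proof (rule sub_shift_greatest)
    fix t :: real
    assume t: "t \<ge> 0"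
    have "sub_shift p y (r *\<^sub>R x) \<le> p (r *\<^sub>R x + (r * t) *\<^sub>R y) - (r * t) * p y"
      by (rule sub_shift_le[OF p]) (use r t in simp)
    also have "\<dots> = r * (p (x + t *\<^sub>R y) - t * p y)"
      using sublinear_scale[OF p, of r "x + t *\<^sub>R y"] r by (simp add: algebra_simps)
    finally show "inverse r * sub_shift p y (r *\<^sub>R x) \<le> p (x + t *\<^sub>R y) - t * p y"
      using r by (simp add: field_simps)
  qed
  then show "sub_shift p y (r *\<^sub>R x) \<le> r * sub_shift p y x"
    using r by (simp add: field_simps)
qed

text \<open>Pointwise infima of sublinear functionals need not be subadditive. In a chain, however,
  \<open>q\<close> and \<open>r\<close> have a common lower member \<open>m\<close>, whose
  subadditivity bounds the infimum at \<open>x + y\<close> by \<open>q x + r y\<close>.\<close>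

lemma sublinear_Inf_chain:
  fixes C :: "('a::real_vector \<Rightarrow> real) set"
  assumes "C \<noteq> {}" and sub: "\<And>q. q \<in> C \<Longrightarrow> sublinear q"
    and chain: "\<And>q r. q \<in> C \<Longrightarrow> r \<in> C \<Longrightarrow> q \<le> r \<or> r \<le> q"
    and bdd: "\<And>x. bdd_below ((\<lambda>q. q x) ` C)"
  shows "sublinear (\<lambda>x. INF q\<in>C. q x)"
proof (rule sublinearI)
  have low: "(INF q\<in>C. q x) \<le> q x" if "q \<in> C" for q x
    using cINF_lower[OF bdd that] .
  show "(INF q\<in>C. q 0) = 0"
  proof -
    have "(INF q\<in>C. q 0) = (INF q\<in>C. (0::real))"
      by (rule INF_cong) (auto simp: sublinear_zero[OF sub])
    then show ?thesis using assms(1) by simp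
  qed
  show "(INF q\<in>C. q (x + y)) \<le> (INF q\<in>C. q x) + (INF q\<in>C. q y)" for x y
  proof -
    have *: "(INF q\<in>C. q (x + y)) \<le> q x + r y" if qr: "q \<in> C" "r \<in> C" for q r
    proof -
      obtain m where m: "m \<in> C" "m \<le> q" "m \<le> r"
        using chain[OF qr] qr by blast
      have "(INF q\<in>C. q (x + y)) \<le> m x + m y"
        using low[OF m(1), of "x + y"] sublinear_add[OF sub[OF m(1)], of x y] by linarith
      then show ?thesis using m(2,3) by (smt (verit) le_funD)
    qed
    have "(INF q\<in>C. q (x + y)) - q x \<le> (INF q\<in>C. q y)" if "q \<in> C" for q
      by (rule cINF_greatest[OF assms(1)]) (use *[OF that] in \<open>force simp: algebra_simps\<close>)
    then have "(INF q\<in>C. q (x + y)) - (INF q\<in>C. q y) \<le> (INF q\<in>C. q x)"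
      by (intro cINF_greatest[OF assms(1)]) (force simp: algebra_simps)
    then show ?thesis by simp
  qed
  show "(INF q\<in>C. q (r *\<^sub>R x)) \<le> r * (INF q\<in>C. q x)" if r: "r > 0" for r x
  proof -
    have "inverse r * (INF q\<in>C. q (r *\<^sub>R x)) \<le> (INF q\<in>C. q x)"
    proof (rule cINF_greatest[OF assms(1)])
      fix q assume q: "q \<in> C"
      show "inverse r * (INF q\<in>C. q (r *\<^sub>R x)) \<le> q x"
        using low[OF q, of "r *\<^sub>R x"] sublinear_scale[OF sub[OF q], of r x] r
        by (simp add: field_simps)
    qed
    then show ?thesis using r by (simp add: field_simps)
  qed
qed

text \<open>Zorn's lemma for the reversed pointwise order on the sublinear functionals below
  \<open>p\<close>; a chain is bounded by its pointwise infimum.\<close>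

lemma minimal_sublinear_exists:
  fixes p :: "'a::real_vector \<Rightarrow> real"
  assumes p: "sublinear p"
  obtains q where "sublinear q" "q \<le> p" "\<And>r. sublinear r \<Longrightarrow> r \<le> q \<Longrightarrow> r = q"
proof -
  let ?A = "{q. sublinear q \<and> q \<le> p}"
  let ?P = "\<lambda>q r :: 'a \<Rightarrow> real. r \<le> q"
  have "\<exists>m\<in>?A. \<forall>a\<in>?A. ?P m a \<longrightarrow> a = m"
  proof (rule predicate_Zorn)
    show "partial_order_on ?A (relation_of ?P ?A)"
      unfolding partial_order_on_def preorder_on_def relation_of_def
      by (auto simp: refl_on_def trans_def antisym_def)
    fix C assume "C \<in> Chains (relation_of ?P ?A)"
    then have C: "\<And>q. q \<in> C \<Longrightarrow> sublinear q" "\<And>q. q \<in> C \<Longrightarrow> q \<le> p"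
      "\<And>q r. q \<in> C \<Longrightarrow> r \<in> C \<Longrightarrow> q \<le> r \<or> r \<le> q"
      by (auto simp: Chains_def relation_of_def)
    show "\<exists>u\<in>?A. \<forall>a\<in>C. ?P a u"
    proof (cases "C = {}")
      case True
      then show ?thesis using p by auto
    next
      case False
      \<comment> \<open>Since \<open>- p (- x) \<le> - q (- x) \<le> q x\<close>, all members of
        \<open>C\<close> share a lower bound at \<open>x\<close>.\<close>
      have bdd: "bdd_below ((\<lambda>q. q x) ` C)" for x
      proof (rule bdd_belowI2)
        fix q assume "q \<in> C"
        then show "- p (- x) \<le> q x"
          using sublinear_minus[OF C(1), of q x] le_funD[OF C(2), of q "- x"] by simp
      qed
      have low: "(\<lambda>x. INF q\<in>C. q x) \<le> q" if "q \<in> C" for q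
        by (intro le_funI cINF_lower[OF bdd that])
      moreover have "(\<lambda>x. INF q\<in>C. q x) \<le> p"
        using False low C(2) by (meson ex_in_conv order_trans)
      ultimately show ?thesis
        using sublinear_Inf_chain[OF False C(1,3) bdd] by auto
    qed
  qed
  then obtain m where m: "sublinear m" "m \<le> p"
    and min: "\<And>a. sublinear a \<Longrightarrow> a \<le> p \<Longrightarrow> a \<le> m \<Longrightarrow> a = m" by auto
  show thesis
    using that[OF m min] m(2) order_trans by blast
qed

text \<open>Minimality forces \<open>sub_shift q y = q\<close>; the bound for \<open>t = 1\<close>
  then says that \<open>q\<close> is superadditive, hence additive.\<close>

lemma minimal_sublinear_linear:
  fixes q :: "'a::real_vector \<Rightarrow> real"
  assumes q: "sublinear q" and min: "\<And>r. sublinear r \<Longrightarrow> r \<le> q \<Longrightarrow> r = q"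
  shows "linear q"
proof -
  have eq: "sub_shift q y = q" for y
    by (rule min[OF sublinear_sub_shift[OF q]]) (simp add: le_funI sub_shift_le_self[OF q])
  have add: "q (x + y) = q x + q y" for x y
    using sub_shift_le[OF q, of 1 y x] sublinear_add[OF q, of x y] by (simp add: eq)
  have neg: "q (- x) = - q x" for x
    using add[of x "- x"] sublinear_zero[OF q] by simp
  have "q (r *\<^sub>R x) = r * q x" for r x
  proof (cases "r \<ge> 0")
    case False
    then show ?thesis
      using neg[of "(- r) *\<^sub>R x"] sublinear_scale[OF q, of "- r" x] by simp
  qed (simp add: sublinear_scale[OF q])
  then show ?thesis by (intro linearI) (auto simp: add)
qed

text \<open>Minimizing below \<open>sub_shift p y\<close> instead of \<open>p\<close> pins the value
  at \<open>y\<close>: \<open>g (- y) \<le> - p y\<close> and linearity give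
  \<open>g y \<ge> p y\<close>.\<close>

theorem hahn_banach_sublinear:
  fixes p :: "'a::real_vector \<Rightarrow> real"
  assumes p: "sublinear p"
  obtains g where "linear g" "\<And>x. g x \<le> p x" "g y = p y"
proof -
  obtain g where g: "sublinear g" "g \<le> sub_shift p y"
    and min: "\<And>r. sublinear r \<Longrightarrow> r \<le> g \<Longrightarrow> r = g"
    using minimal_sublinear_exists[OF sublinear_sub_shift[OF p]] by blast
  have lin: "linear g" by (rule minimal_sublinear_linear[OF g(1) min])
  have le: "g x \<le> p x" for x
    using le_funD[OF g(2), of x] sub_shift_le_self[OF p, of y x] by simp
  have "g (- y) \<le> - p y"
    using le_funD[OF g(2), of "- y"] sub_shift_minus[OF p, of y] by simp
  then have "g y = p y"
    using le[of y] linear_neg[OF lin, of y] by simp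
  then show thesis using that[OF lin le] by simp
qed

section \<open>One-sided directional derivatives of the norm\<close>

lemma norm_directional_derivative:
  fixes x y :: "'a::real_normed_vector"
  shows "((\<lambda>t. (norm (x + t *\<^sub>R y) - norm x) / t) \<longlongrightarrow> sub_shift norm x y) (at_right 0)"
proof -
  \<comment> \<open>The substitution \<open>s = 1 / t\<close> turns the difference quotient into
    \<open>h s\<close>. As \<open>h\<close> is nonincreasing, its limit for large \<open>s\<close>
    is its infimum over \<open>s \<ge> 0\<close>, which is
    \<open>sub_shift norm x y\<close>.\<close>
  define h where "h s = norm (y + s *\<^sub>R x) - s * norm x" for s
  have anti: "h s' \<le> h s" if "s \<le> s'" for s s'
  proof -
    have "norm ((y + s *\<^sub>R x) + (s' - s) *\<^sub>R x) \<le> norm (y + s *\<^sub>R x) + (s' - s) * norm x"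
      using norm_triangle_ineq[of "y + s *\<^sub>R x" "(s' - s) *\<^sub>R x"] that by simp
    then show ?thesis by (simp add: h_def algebra_simps)
  qed
  have quot: "(norm (x + t *\<^sub>R y) - norm x) / t = h (1 / t)" if "t > 0" for t
  proof -
    have "x + t *\<^sub>R y = t *\<^sub>R (y + (1 / t) *\<^sub>R x)" using that by (simp add: algebra_simps)
    then have "norm (x + t *\<^sub>R y) = t * norm (y + (1 / t) *\<^sub>R x)"
      using that by simp
    then show ?thesis using that by (simp add: h_def field_simps)
  qed
  have low: "sub_shift norm x y \<le> h s" if "s \<ge> 0" for s
    using sub_shift_le[OF sublinear_norm that, of x y] by (simp add: h_def)
  have up: "\<exists>s\<ge>0. h s < u" if "sub_shift norm x y < u" for u
    using sub_shift_greatest[of u norm y x] that by (auto simp: h_def not_less) (meson not_less)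
  show ?thesis
  proof (rule order_tendstoI)
    fix l assume l: "l < sub_shift norm x y"
    show "\<forall>\<^sub>F t in at_right 0. l < (norm (x + t *\<^sub>R y) - norm x) / t"
      using eventually_at_right_less[of 0]
    proof eventually_elim
      case (elim t)
      then show ?case using l low[of "1 / t"] by (simp add: quot)
    qed
  next
    fix u assume "sub_shift norm x y < u"
    then obtain s where s: "s \<ge> 0" "h s < u" using up by blast
    \<comment> \<open>The bound \<open>1 / (s + 1)\<close> ensures \<open>s < 1 / t\<close> and also
      makes sense for \<open>s = 0\<close>.\<close>
    have "\<forall>\<^sub>F t in at_right 0. t \<in> {0<..<1 / (s + 1)}"
      by (rule eventually_at_right_real) (use s in simp)
    then show "\<forall>\<^sub>F t in at_right 0. (norm (x + t *\<^sub>R y) - norm x) / t < u"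
    proof eventually_elim
      case (elim t)
      then have "s + 1 < 1 / t" using s(1) by (auto simp: field_simps)
      then show ?case using anti[of s "1 / t"] s elim by (simp add: quot)
    qed
  qed
qed

section \<open>The Krein--Milman theorem\<close>

text \<open>Stands in for a Hausdorff locally convex space. The topology is a parameter because the
  one to be used on bounded linear maps is not the norm topology of that type.\<close>

locale separated_dual =
  fixes T :: "'b::real_vector topology"
  assumes topspace_eq: "topspace T = UNIV"
    and separating: "(v::'b) \<noteq> w \<Longrightarrow> \<exists>\<phi>. linear \<phi> \<and> continuous_map T euclideanreal \<phi> \<and> \<phi> v \<noteq> \<phi> w"
    and continuous_affine: "continuous_map T T (\<lambda>v::'b. u *\<^sub>R v + w)"
begin

lemma Hausdorff: "Hausdorff_space T"
  unfolding Hausdorff_space_def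
proof (intro allI impI, elim conjE)
  fix v w :: 'b assume "v \<noteq> w"
  then obtain \<phi> where \<phi>: "continuous_map T euclideanreal \<phi>" "\<phi> v \<noteq> \<phi> w"
    using separating by blast
  obtain U V where UV: "open U" "open V" "\<phi> v \<in> U" "\<phi> w \<in> V" "U \<inter> V = {}"
    using hausdorff[OF \<phi>(2)] by blast
  show "\<exists>U V. openin T U \<and> openin T V \<and> v \<in> U \<and> w \<in> V \<and> disjnt U V"
  proof (intro exI conjI)
    show "openin T {z \<in> topspace T. \<phi> z \<in> U}" "openin T {z \<in> topspace T. \<phi> z \<in> V}"
      using openin_continuous_map_preimage[OF \<phi>(1)] UV by auto
  qed (use UV in \<open>auto simp: topspace_eq disjnt_def\<close>)
qed

text \<open>Compactness makes \<open>\<phi>\<close> attain its maximum, and a combination with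
  positive weights reaches it only if both end points do. Such exposed faces are used to cut down
  larger faces.\<close>

lemma maximal_face:
  assumes K: "compactin T K" "convex K" "K \<noteq> {}"
    and \<phi>: "linear \<phi>" "continuous_map T euclideanreal \<phi>"
  obtains m where "m \<in> K" "\<And>v. v \<in> K \<Longrightarrow> \<phi> v \<le> \<phi> m"
    "{v \<in> K. \<phi> v = \<phi> m} face_of K" "closedin T {v \<in> K. \<phi> v = \<phi> m}"
proof -
  have "compact (\<phi> ` K)"
    using image_compactin[OF K(1) \<phi>(2)] by simp
  then obtain m where m: "m \<in> K" "\<And>v. v \<in> K \<Longrightarrow> \<phi> v \<le> \<phi> m"
    using compact_attains_sup[of "\<phi> ` K"] K(3) by auto
  have comb: "\<phi> ((1 - u) *\<^sub>R a + u *\<^sub>R b) = (1 - u) * \<phi> a + u * \<phi> b" for u a b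
    by (simp add: linear_add[OF \<phi>(1)] linear_scale[OF \<phi>(1)])
  have "convex {v \<in> K. \<phi> v = \<phi> m}"
    using K(2) unfolding convex_alt by (auto simp: comb left_diff_distrib)
  moreover have "a \<in> {v \<in> K. \<phi> v = \<phi> m} \<and> b \<in> {v \<in> K. \<phi> v = \<phi> m}"
    if ab: "a \<in> K" "b \<in> K" and c: "\<phi> c = \<phi> m" "c \<in> open_segment a b" for a b c
  proof -
    obtain u where u: "0 < u" "u < 1" "c = (1 - u) *\<^sub>R a + u *\<^sub>R b"
      using c(2) by (auto simp: in_segment)
    have "(1 - u) * (\<phi> m - \<phi> a) + u * (\<phi> m - \<phi> b) = 0"
      using c(1) comb[of u a b] u(3) by (simp add: algebra_simps)
    moreover have "(1 - u) * (\<phi> m - \<phi> a) \<ge> 0" "u * (\<phi> m - \<phi> b) \<ge> 0"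
      using m(2) ab u by simp_all
    ultimately have "(1 - u) * (\<phi> m - \<phi> a) = 0" "u * (\<phi> m - \<phi> b) = 0"
      by linarith+
    then show ?thesis using ab u by simp
  qed
  ultimately have face: "{v \<in> K. \<phi> v = \<phi> m} face_of K"
    unfolding face_of_def by blast
  have "closedin T {v \<in> K. \<phi> v \<in> {\<phi> m}}"
    by (rule closedin_continuous_map_preimage_gen[OF \<phi>(2)])
      (use compactin_imp_closedin[OF Hausdorff K(1)] in auto)
  then show thesis using that[OF m face] by simp
qed

text \<open>A minimal nonempty closed face is a single point: a functional separating two of its
  points would be maximal on a strictly smaller face. Faces of faces are faces, so this point is
  extreme in \<open>K\<close>.\<close>

lemma extreme_point_exists:
  assumes K: "compactin T K" "convex K" "K \<noteq> {}"
  obtains v where "v extreme_point_of K"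
proof -
  let ?F = "{F. F face_of K \<and> closedin T F \<and> F \<noteq> {}}"
  have KF: "K \<in> ?F"
    using K compactin_imp_closedin[OF Hausdorff K(1)] face_of_refl by auto
  \<comment> \<open>Zorn's lemma for inclusion yields maximal sets; passing to complements yields a
    minimal face.\<close>
  have "\<exists>M\<in>uminus ` ?F. \<forall>X\<in>uminus ` ?F. M \<subseteq> X \<longrightarrow> X = M"
  proof (rule subset_Zorn_nonempty)
    show "uminus ` ?F \<noteq> {}" using KF by blast
    fix C assume C: "C \<noteq> {}" "subset.chain (uminus ` ?F) C"
    define D where "D = uminus ` C"
    have D: "D \<noteq> {}" "D \<subseteq> ?F" "\<And>X Y. X \<in> D \<Longrightarrow> Y \<in> D \<Longrightarrow> X \<subseteq> Y \<or> Y \<subseteq> X"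
      using C by (auto simp: D_def subset_chain_def)
    \<comment> \<open>A nonempty finite part of a chain has a smallest member, and this is its
      intersection.\<close>
    have fin: "\<Inter>E \<in> E" if "finite E" "E \<noteq> {}" "E \<subseteq> D" for E
      using that
    proof (induction E rule: finite_ne_induct)
      case (insert X E)
      then have "\<Inter>E \<in> D" "X \<in> D" by auto
      then have "X \<subseteq> \<Inter>E \<or> \<Inter>E \<subseteq> X" using D(3) by blast
      then show ?case
      proof
        assume "X \<subseteq> \<Inter>E"
        then have "\<Inter>(insert X E) = X" by auto
        then show ?case by simp
      next
        assume "\<Inter>E \<subseteq> X"
        then have "\<Inter>(insert X E) = \<Inter>E" by auto
        then show ?case using insert by simp
      qed
    qed simp
    have "K \<inter> \<Inter>D \<noteq> {}"
    proof (rule compactin_fip[THEN iffD1, OF K(1), THEN conjunct2, rule_format], intro conjI ballI allI impI)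
      show "closedin T X" if "X \<in> D" for X using D(2) that by auto
      fix E assume E: "finite E \<and> E \<subseteq> D"
      show "K \<inter> \<Inter>E \<noteq> {}"
      proof (cases "E = {}")
        case False
        then have "\<Inter>E \<in> ?F" using fin E D(2) by blast
        then show ?thesis using face_of_imp_subset by fastforce
      qed (use K in simp)
    qed
    moreover have "(\<Inter>D) face_of K" "closedin T (\<Inter>D)"
      using D by (auto intro!: face_of_Inter closedin_Inter)
    ultimately have "\<Inter>D \<in> ?F" by blast
    moreover have "\<Union>C = - \<Inter>D" by (auto simp: D_def)
    ultimately show "\<Union>C \<in> uminus ` ?F" by blast
  qed
  then obtain F where F: "F face_of K" "closedin T F" "F \<noteq> {}"
    and min: "\<And>G. G face_of K \<Longrightarrow> closedin T G \<Longrightarrow> G \<noteq> {} \<Longrightarrow> G \<subseteq> F \<Longrightarrow> G = F"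
    by auto
  have cpt: "compactin T F"
    using closed_compactin[OF K(1) face_of_imp_subset[OF F(1)] F(2)] .
  obtain v where v: "v \<in> F" using F(3) by blast
  have "w = v" if w: "w \<in> F" for w
  proof (rule ccontr)
    assume "w \<noteq> v"
    then obtain \<phi> where \<phi>: "linear \<phi>" "continuous_map T euclideanreal \<phi>" "\<phi> w \<noteq> \<phi> v"
      using separating by blast
    obtain m where m: "m \<in> F" "{z \<in> F. \<phi> z = \<phi> m} face_of F" "closedin T {z \<in> F. \<phi> z = \<phi> m}"
      using maximal_face[OF cpt face_of_imp_convex[OF F(1)] F(3) \<phi>(1,2)] by blast
    have "{z \<in> F. \<phi> z = \<phi> m} = F"
      using m by (intro min face_of_trans[OF m(2) F(1)]) auto
    then have "\<phi> w = \<phi> m" "\<phi> v = \<phi> m" using v w by blast+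
    then show False using \<phi>(3) by simp
  qed
  then have "F = {v}" using v by blast
  then show thesis using F(1) that face_of_singleton by blast
qed

text \<open>The maximum is attained on a whole closed face, and an extreme point of this face is
  extreme in \<open>K\<close> as well.\<close>

lemma extreme_point_maximizes:
  assumes K: "compactin T K" "convex K" "K \<noteq> {}"
    and \<phi>: "linear \<phi>" "continuous_map T euclideanreal \<phi>"
  obtains e where "e extreme_point_of K" "\<And>v. v \<in> K \<Longrightarrow> \<phi> v \<le> \<phi> e"
proof -
  obtain m where m: "m \<in> K" "\<And>v. v \<in> K \<Longrightarrow> \<phi> v \<le> \<phi> m"
    and F: "{v \<in> K. \<phi> v = \<phi> m} face_of K" "closedin T {v \<in> K. \<phi> v = \<phi> m}"
    using maximal_face[OF K \<phi>] by blast
  have "compactin T {v \<in> K. \<phi> v = \<phi> m}"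
    using closed_compactin[OF K(1) face_of_imp_subset[OF F(1)] F(2)] .
  then obtain e where "e extreme_point_of {v \<in> K. \<phi> v = \<phi> m}"
    using extreme_point_exists face_of_imp_convex[OF F(1)] m(1) by blast
  then have "e extreme_point_of K" "\<phi> e = \<phi> m"
    using extreme_point_of_face[OF F(1)] by auto
  then show thesis using that m(2) by simp
qed

text \<open>Since \<open>continuous_affine\<close> concerns one variable at a time, there are two
  passes: first one end point is moved into the closure while the other stays in \<open>C\<close>,
  then the other follows.\<close>

lemma convex_closure_of:
  assumes C: "convex C"
  shows "convex (T closure_of C)"
  unfolding convex_alt
proof (intro ballI allI impI)
  have clos: "(1 - u) *\<^sub>R v + u *\<^sub>R w \<in> T closure_of C"
    if "v \<in> T closure_of C" "w \<in> C" "0 \<le> u" "u \<le> 1" for v w u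
  proof -
    have "(\<lambda>v. (1 - u) *\<^sub>R v + u *\<^sub>R w) ` C \<subseteq> C"
      using convexD_alt[OF C] that by blast
    then show ?thesis
      using continuous_map_image_closure_subset[OF continuous_affine, of "1 - u" "u *\<^sub>R w" C]
        closure_of_mono that(1) by blast
  qed
  fix v w :: 'b and u :: real
  assume vw: "v \<in> T closure_of C" "w \<in> T closure_of C" and u: "0 \<le> u \<and> u \<le> 1"
  have "(\<lambda>w. u *\<^sub>R w + (1 - u) *\<^sub>R v) ` C \<subseteq> T closure_of C"
    using clos[OF vw(1)] u by (auto simp: add.commute)
  then have "T closure_of ((\<lambda>w. u *\<^sub>R w + (1 - u) *\<^sub>R v) ` C) \<subseteq> T closure_of C"
    by (metis closure_of_closure_of closure_of_mono)
  then have "u *\<^sub>R w + (1 - u) *\<^sub>R v \<in> T closure_of C"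
    using continuous_map_image_closure_subset[OF continuous_affine, of u "(1 - u) *\<^sub>R v" C] vw(2)
    by blast
  then show "(1 - u) *\<^sub>R v + u *\<^sub>R w \<in> T closure_of C" by (simp add: add.commute)
qed

text \<open>By compactness finitely many functionals already separate \<open>f\<close> from \<open>C\<close>; projecting \<open>f\<close> to
  the nearest point \<open>g\<close> of \<open>C\<close> in the Euclidean seminorm they define gives the separating functional.\<close>

lemma separation:
  assumes C: "compactin T C" "convex C" and f: "f \<notin> C"
  obtains \<psi> where "linear \<psi>" "continuous_map T euclideanreal \<psi>" "\<And>v. v \<in> C \<Longrightarrow> \<psi> v < \<psi> f"
proof (cases "C = {}")
  case True
  then show thesis using that[of "\<lambda>_. 0"] by (simp add: linear_zero)
next
  case False
  let ?\<Phi> = "{\<phi>. linear \<phi> \<and> continuous_map T euclideanreal \<phi>}"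
  have op: "openin T {v. \<phi> v \<noteq> \<phi> f}" if "\<phi> \<in> ?\<Phi>" for \<phi>
  proof -
    have "openin T {v \<in> topspace T. \<phi> v \<in> - {\<phi> f}}"
      using that by (intro openin_continuous_map_preimage) auto
    then show ?thesis by (simp add: topspace_eq)
  qed
  have "C \<subseteq> (\<Union>\<phi>\<in>?\<Phi>. {v. \<phi> v \<noteq> \<phi> f})"
  proof
    fix v assume "v \<in> C"
    then have "v \<noteq> f" using f by blast
    then obtain \<phi> where "\<phi> \<in> ?\<Phi>" "\<phi> v \<noteq> \<phi> f" using separating[of v f] by blast
    then show "v \<in> (\<Union>\<phi>\<in>?\<Phi>. {v. \<phi> v \<noteq> \<phi> f})" by blast
  qed
  then obtain \<F> where \<F>: "finite \<F>" "\<F> \<subseteq> (\<lambda>\<phi>. {v. \<phi> v \<noteq> \<phi> f}) ` ?\<Phi>" "C \<subseteq> \<Union>\<F>"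
    using C(1) op unfolding compactin_def by (metis (no_types, lifting) imageE)
  obtain F where F: "F \<subseteq> ?\<Phi>" "finite F" "\<F> = (\<lambda>\<phi>. {v. \<phi> v \<noteq> \<phi> f}) ` F"
    using finite_subset_image[OF \<F>(1,2)] by blast
  have lin: "linear \<phi>" and cont: "continuous_map T euclideanreal \<phi>" if "\<phi> \<in> F" for \<phi>
    using F(1) that by auto
  define N where "N v = (\<Sum>\<phi>\<in>F. (\<phi> v - \<phi> f)\<^sup>2)" for v
  have "continuous_map T euclideanreal N"
    unfolding N_def by (intro continuous_intros F(2) cont)
  then have "compact (N ` C)"
    using image_compactin[OF C(1)] by fastforce
  then obtain g where g: "g \<in> C" "\<And>v. v \<in> C \<Longrightarrow> N g \<le> N v"
    using compact_attains_inf[of "N ` C"] False by auto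
  \<comment> \<open>The inner product with \<open>f - g\<close> in the coordinates \<open>F\<close>,
    so that \<open>\<psi> f - \<psi> g\<close> is the squared distance \<open>N g\<close>.\<close>
  define \<psi> where "\<psi> v = (\<Sum>\<phi>\<in>F. (\<phi> f - \<phi> g) * \<phi> v)" for v
  have lin\<psi>: "linear \<psi>"
  proof (rule linearI)
    show "\<psi> (v + w) = \<psi> v + \<psi> w" for v w
      by (simp add: \<psi>_def linear_add[OF lin] sum.distrib distrib_left)
    show "\<psi> (r *\<^sub>R v) = r *\<^sub>R \<psi> v" for r v
      by (simp add: \<psi>_def linear_scale[OF lin] sum_distrib_left mult.left_commute)
  qed
  have cont\<psi>: "continuous_map T euclideanreal \<psi>"
    unfolding \<psi>_def by (intro continuous_intros F(2) cont)
  have "N g > 0"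
  proof -
    obtain \<phi> where "\<phi> \<in> F" "\<phi> g \<noteq> \<phi> f" using g(1) \<F>(3) F(3) by blast
    then show ?thesis
      unfolding N_def by (intro sum_pos2[OF F(2)]) auto
  qed
  moreover have "\<psi> f - \<psi> g = N g"
    by (simp add: \<psi>_def N_def sum_subtractf[symmetric] power2_eq_square algebra_simps)
  moreover have "\<psi> v \<le> \<psi> g" if v: "v \<in> C" for v
  proof (rule ccontr)
    assume neg: "\<not> \<psi> v \<le> \<psi> g"
    define Q where "Q = (\<Sum>\<phi>\<in>F. (\<phi> v - \<phi> g)\<^sup>2)"
    have Q: "Q \<ge> 0" by (simp add: Q_def sum_nonneg)
    \<comment> \<open>Along the segment from \<open>g\<close> to \<open>v\<close> the squared
      distance to \<open>f\<close> is quadratic in \<open>u\<close>, with slope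
      \<open>- 2 * (\<psi> v - \<psi> g)\<close> at \<open>g\<close>. A negative slope contradicts
      the choice of \<open>g\<close>.\<close>
    have ex: "N ((1 - u) *\<^sub>R g + u *\<^sub>R v) = N g - 2 * u * (\<psi> v - \<psi> g) + u\<^sup>2 * Q" for u
    proof -
      have "(\<phi> ((1 - u) *\<^sub>R g + u *\<^sub>R v) - \<phi> f)\<^sup>2 = (\<phi> g - \<phi> f)\<^sup>2
          - 2 * u * ((\<phi> f - \<phi> g) * \<phi> v - (\<phi> f - \<phi> g) * \<phi> g) + u\<^sup>2 * (\<phi> v - \<phi> g)\<^sup>2"
        if "\<phi> \<in> F" for \<phi>
      proof -
        have "\<phi> ((1 - u) *\<^sub>R g + u *\<^sub>R v) = (1 - u) * \<phi> g + u * \<phi> v"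
          by (simp add: linear_add[OF lin[OF that]] linear_scale[OF lin[OF that]])
        then show ?thesis by (simp only: power2_eq_square) (simp add: algebra_simps)
      qed
      then show ?thesis
        by (simp add: N_def \<psi>_def Q_def sum.distrib sum_subtractf flip: sum_distrib_left)
    qed
    define d where "d = \<psi> v - \<psi> g"
    have d: "d > 0" using neg by (simp add: d_def)
    \<comment> \<open>Chosen so that \<open>u \<le> 1\<close> and
      \<open>u * Q \<le> d < 2 * d\<close>, including the case \<open>Q = 0\<close>: the quadratic
      is then below its value at \<open>0\<close>.\<close>
    define u where "u = d / (d + Q)"
    have u: "0 < u" "u \<le> 1" "u * Q < 2 * d"
      using d Q by (auto simp: u_def field_simps add_pos_nonneg intro!: add_nonneg_pos)
    have "(1 - u) *\<^sub>R g + u *\<^sub>R v \<in> C"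
      using convexD_alt[OF C(2) g(1) v] u by simp
    then have "0 \<le> u * (u * Q - 2 * d)"
      using g(2) ex[of u] by (force simp: d_def power2_eq_square algebra_simps)
    then show False using u by (simp add: zero_le_mult_iff)
  qed
  ultimately show thesis
    using that[OF lin\<psi> cont\<psi>] by fastforce
qed

text \<open>A point of \<open>K\<close> outside the closed hull would be strictly separated from it
  by a functional, but that functional attains its maximum over \<open>K\<close> at an extreme
  point, which lies in the hull.\<close>

theorem krein_milman:
  assumes K: "compactin T K" "convex K"
  shows "K = T closure_of (convex hull {e. e extreme_point_of K})"
proof
  let ?C = "T closure_of (convex hull {e. e extreme_point_of K})"
  have "convex hull {e. e extreme_point_of K} \<subseteq> K"
    by (rule hull_minimal) (auto simp: extreme_point_of_def K)
  then show sub: "?C \<subseteq> K"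
    using closure_of_minimal compactin_imp_closedin[OF Hausdorff K(1)] by blast
  have C: "compactin T ?C" "convex ?C"
    using closed_compactin[OF K(1) sub] convex_closure_of by auto
  show "K \<subseteq> ?C"
  proof (rule ccontr)
    assume "\<not> K \<subseteq> ?C"
    then obtain f where f: "f \<in> K" "f \<notin> ?C" by blast
    obtain \<psi> where \<psi>: "linear \<psi>" "continuous_map T euclideanreal \<psi>" "\<And>v. v \<in> ?C \<Longrightarrow> \<psi> v < \<psi> f"
      using separation[OF C f(2)] by blast
    obtain e where e: "e extreme_point_of K" "\<And>v. v \<in> K \<Longrightarrow> \<psi> v \<le> \<psi> e"
      using extreme_point_maximizes[OF K _ \<psi>(1,2)] f(1) by blast
    have "e \<in> ?C"
      using closure_of_subset[of "convex hull {e. e extreme_point_of K}" T] e(1)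
      by (auto simp: topspace_eq intro: hull_inc)
    then show False using \<psi>(3) e(2)[OF f(1)] by fastforce
  qed
qed

end

section \<open>Weak-star compactness\<close>

text \<open>The separating functionals are the real and imaginary parts of evaluations; continuity
  of affine maps is checked pointwise.\<close>

interpretation sot: separated_dual "strong_operator_topology :: ('a::real_normed_vector \<Rightarrow>\<^sub>L complex) topology"
proof
  show "topspace strong_operator_topology = (UNIV :: ('a \<Rightarrow>\<^sub>L complex) set)"
    by (rule strong_operator_topology_topspace)
  fix v w :: "'a \<Rightarrow>\<^sub>L complex" and u :: real
  have eval: "linear (\<lambda>f. h (blinfun_apply f z)) \<and>
      continuous_map strong_operator_topology euclideanreal (\<lambda>f. h (blinfun_apply f z))"
    if h: "bounded_linear h" for z :: 'a and h :: "complex \<Rightarrow> real"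
  proof
    show "linear (\<lambda>f. h (blinfun_apply f z))"
      by (rule linearI) (simp_all add: blinfun.bilinear_simps bounded_linear.linear[OF h] linear_add linear_scale)
    have "continuous_map strong_operator_topology euclideanreal (h \<circ> (\<lambda>f. blinfun_apply f z))"
      by (rule continuous_map_compose[OF strong_operator_topology_continuous_evaluation])
        (simp add: linear_continuous_on[OF h])
    then show "continuous_map strong_operator_topology euclideanreal (\<lambda>f. h (blinfun_apply f z))"
      by (simp only: o_def)
  qed
  show "\<exists>\<phi>. linear \<phi> \<and> continuous_map strong_operator_topology euclideanreal \<phi> \<and> \<phi> v \<noteq> \<phi> w"
    if neq: "v \<noteq> w"
  proof -
    obtain z where "blinfun_apply v z \<noteq> blinfun_apply w z"
      using neq blinfun_eqI[of v w] by blast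
    then show ?thesis
      using eval[OF bounded_linear_Re, of z] eval[OF bounded_linear_Im, of z]
      by (metis complex_eq_iff)
  qed
  show "continuous_map strong_operator_topology strong_operator_topology (\<lambda>v. u *\<^sub>R v + w)"
    unfolding continuous_on_strong_operator_topo_iff_coordinatewise
  proof
    fix z
    have "continuous_map strong_operator_topology euclidean ((\<lambda>c. u *\<^sub>R c + blinfun_apply w z) \<circ> (\<lambda>v. blinfun_apply v z))"
      by (rule continuous_map_compose[OF strong_operator_topology_continuous_evaluation])
        (simp only: continuous_map_iff_continuous2, intro continuous_intros)
    then show "continuous_map strong_operator_topology euclidean (\<lambda>v. blinfun_apply (u *\<^sub>R v + w) z)"
      by (simp add: o_def blinfun.bilinear_simps)
  qed
qed

text \<open>Open sets of the pullback are full preimages, so covers of \<open>K\<close> pass to its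
  image under \<open>f\<close> and finite subcovers pass back.\<close>

lemma compactin_pullback_topology:
  assumes "compactin S (f ` K)"
  shows "compactin (pullback_topology UNIV f S) K"
  unfolding compactin_def
proof (intro conjI allI impI)
  show "K \<subseteq> topspace (pullback_topology UNIV f S)"
    using compactin_subset_topspace[OF assms] by (auto simp: topspace_pullback_topology)
  fix \<U> assume \<U>: "Ball \<U> (openin (pullback_topology UNIV f S)) \<and> K \<subseteq> \<Union>\<U>"
  then have "\<forall>U\<in>\<U>. \<exists>W. openin S W \<and> U = f -` W"
    by (simp add: openin_pullback_topology)
  then obtain V where V: "\<forall>U\<in>\<U>. openin S (V U) \<and> U = f -` V U"
    by (rule bchoice[THEN exE])
  have "f ` K \<subseteq> \<Union>(V ` \<U>)"
  proof (rule image_subsetI)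
    fix k assume "k \<in> K"
    then obtain U where "U \<in> \<U>" "k \<in> U" using \<U> by blast
    then show "f k \<in> \<Union>(V ` \<U>)" using V by blast
  qed
  moreover have "\<forall>W\<in>V ` \<U>. openin S W" using V by blast
  ultimately obtain \<F> where \<F>: "finite \<F>" "\<F> \<subseteq> V ` \<U>" "f ` K \<subseteq> \<Union>\<F>"
    using assms[unfolded compactin_def, THEN conjunct2, THEN spec, of "V ` \<U>"] by blast
  obtain \<G> where \<G>: "\<G> \<subseteq> \<U>" "finite \<G>" "\<F> = V ` \<G>"
    using finite_subset_image[OF \<F>(1,2)] by blast
  have "K \<subseteq> \<Union>\<G>"
  proof
    fix k assume "k \<in> K"
    then obtain U where U: "U \<in> \<G>" "f k \<in> V U" using \<F>(3) \<G>(3) by blast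
    then have "k \<in> U" using V \<G>(1) by blast
    then show "k \<in> \<Union>\<G>" using U(1) by blast
  qed
  then show "\<exists>\<F>. finite \<F> \<and> \<F> \<subseteq> \<U> \<and> K \<subseteq> \<Union>\<F>" using \<G> by blast
qed

text \<open>Evaluation identifies the dual ball with the complex-linear functions in a product of
  closed discs. The product is compact by Tychonoff's theorem, the discs encode the norm bound, and
  linearity is a closed condition. The strong operator topology is the pullback along this
  identification.\<close>

lemma banach_alaoglu:
  "compactin strong_operator_topology {f \<in> cdual :: ('a::complex_normed_vector \<Rightarrow>\<^sub>L complex) set. norm f \<le> 1}"
proof -
  let ?B = "{f \<in> cdual :: ('a \<Rightarrow>\<^sub>L complex) set. norm f \<le> 1}"
  let ?P = "Pi\<^sub>E UNIV (\<lambda>z::'a. cball (0::complex) (norm z))"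
  let ?L = "{h :: 'a \<Rightarrow> complex. (\<forall>u v. h (u + v) = h u + h v) \<and> (\<forall>c u. h (c *\<^sub>C u) = c * h u)}"
  have "compactin (product_topology (\<lambda>_. euclidean) UNIV) ?P"
    by (subst compactin_PiE) simp
  then have "compact ?P" by (simp add: euclidean_product_topology)
  moreover have "closed ?L"
    by (intro closed_Collect_conj closed_Collect_all closed_Collect_eq continuous_intros
        continuous_on_product_coordinates)
  ultimately have "compact (?P \<inter> ?L)" by blast
  also have "?P \<inter> ?L = blinfun_apply ` ?B"
  proof (intro equalityI subsetI)
    fix h assume "h \<in> ?P \<inter> ?L"
    then have le: "\<And>z. norm (h z) \<le> norm z" and add: "\<And>u v. h (u + v) = h u + h v"
      and sc: "\<And>c u. h (c *\<^sub>C u) = c * h u" by auto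
    have "h (r *\<^sub>R u) = r *\<^sub>R h u" for r u
      using sc[of "complex_of_real r" u] by (simp add: scaleC_of_real scaleR_conv_of_real)
    then have "bounded_linear h"
      by (intro bounded_linear_intro[where K = 1]) (auto simp: add le)
    then have h: "blinfun_apply (Blinfun h) = h" by (rule bounded_linear_Blinfun_apply)
    have "norm (Blinfun h) \<le> 1"
      by (rule norm_blinfun_bound) (auto simp: h le)
    then have "Blinfun h \<in> ?B" by (simp add: cdual_def h sc)
    then show "h \<in> blinfun_apply ` ?B" using h by force
  next
    fix h assume "h \<in> blinfun_apply ` ?B"
    then obtain f where f: "h = blinfun_apply f" "f \<in> cdual" "norm f \<le> 1" by auto
    have "norm (blinfun_apply f z) \<le> norm z" for z
      using norm_blinfun[of f z] mult_right_mono[OF f(3), of "norm z"] by simp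
    then show "h \<in> ?P \<inter> ?L" using f by (auto simp: cdual_def blinfun.add_right)
  qed
  finally have "compactin euclidean (blinfun_apply ` ?B)" by simp
  then show ?thesis
    unfolding strong_operator_topology_def by (rule compactin_pullback_topology)
qed

lemma cdual_add: "f \<in> cdual \<Longrightarrow> g \<in> cdual \<Longrightarrow> f + g \<in> cdual"
  and cdual_diff: "f \<in> cdual \<Longrightarrow> g \<in> cdual \<Longrightarrow> f - g \<in> cdual"
  and cdual_scaleR: "f \<in> cdual \<Longrightarrow> r *\<^sub>R f \<in> cdual"
  by (auto simp: cdual_def blinfun.bilinear_simps algebra_simps)

lemma convex_cdual_ball: "convex {f \<in> cdual. norm f \<le> 1}"
proof -
  have "convex (cdual \<inter> cball 0 1)"
    by (auto intro!: convex_Int convexI[of cdual] cdual_add cdual_scaleR)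
  moreover have "cdual \<inter> cball 0 1 = {f \<in> cdual. norm f \<le> 1}" by auto
  ultimately show ?thesis by (rule back_subst)
qed

section \<open>Subdifferentials and M-ideals\<close>

lemma blinfun_apply_le_norm:
  "norm f \<le> 1 \<Longrightarrow> norm (blinfun_apply f z) \<le> norm z"
  using norm_blinfun[of f z] mult_right_mono[of "norm f" 1 "norm z"] by simp

text \<open>The value \<open>1\<close> at a unit vector already forces norm at least
  \<open>1\<close>. This exhibits the subdifferential as a slice of the compact dual ball.\<close>

lemma norm_subdiff_unit:
  fixes x :: "'a::complex_normed_vector"
  assumes x: "norm x = 1"
  shows "norm_subdiff x = {f \<in> {f \<in> cdual. norm f \<le> 1}. blinfun_apply f x = 1}"
proof -
  have "norm f = 1" if "norm f \<le> 1" "blinfun_apply f x = 1" for f :: "'a \<Rightarrow>\<^sub>L complex"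
    using norm_blinfun[of f x] that x by simp
  then show ?thesis by (auto simp: norm_subdiff_def x)
qed

lemma norm_subdiff_compact_convex:
  fixes x :: "'a::complex_normed_vector"
  assumes x: "norm x = 1"
  shows "compactin strong_operator_topology (norm_subdiff x)" "convex (norm_subdiff x)"
proof -
  let ?B = "{f \<in> cdual :: ('a \<Rightarrow>\<^sub>L complex) set. norm f \<le> 1}"
  have "closedin strong_operator_topology {f \<in> ?B. blinfun_apply f x \<in> {1}}"
    by (rule closedin_continuous_map_preimage_gen[OF strong_operator_topology_continuous_evaluation])
      (use compactin_imp_closedin[OF sot.Hausdorff banach_alaoglu] in auto)
  then have "closedin strong_operator_topology (norm_subdiff x)"
    by (simp add: norm_subdiff_unit[OF x])
  moreover have "norm_subdiff x \<subseteq> ?B" by (auto simp: norm_subdiff_unit[OF x])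
  ultimately show "compactin strong_operator_topology (norm_subdiff x)"
    by (rule closed_compactin[OF banach_alaoglu, rotated])
  have "convex {f :: 'a \<Rightarrow>\<^sub>L complex. blinfun_apply f x = 1}"
    by (rule convexI) (simp add: blinfun.bilinear_simps scaleR_conv_of_real flip: of_real_add)
  then have "convex (?B \<inter> {f. blinfun_apply f x = 1})"
    by (rule convex_Int[OF convex_cdual_ball])
  moreover have "norm_subdiff x = ?B \<inter> {f. blinfun_apply f x = 1}"
    by (auto simp: norm_subdiff_unit[OF x])
  ultimately show "convex (norm_subdiff x)" by simp
qed

text \<open>The values of \<open>f\<close> at \<open>x\<close> and \<open>x - j\<close> agree.
  Dividing by \<open>norm f\<close> leaves a quantity below every \<open>dist x j\<close>, hence
  below their infimum.\<close>

lemma norm_annihilator_le_infdist: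
  assumes f: "f \<in> annihilator J" and "J \<noteq> {}"
  shows "norm (blinfun_apply f x) \<le> norm f * infdist x J"
proof (cases "norm f = 0")
  case False
  have "norm (blinfun_apply f x) / norm f \<le> infdist x J"
    unfolding infdist_notempty[OF assms(2)]
  proof (rule cINF_greatest[OF assms(2)])
    fix j assume "j \<in> J"
    then have "blinfun_apply f x = blinfun_apply f (x - j)"
      using f by (simp add: annihilator_def blinfun.diff_right)
    then show "norm (blinfun_apply f x) / norm f \<le> dist x j"
      using norm_blinfun[of f "x - j"] False by (simp add: dist_norm field_simps)
  qed
  then show ?thesis using False by (simp add: field_simps)
qed simp

text \<open>With \<open>norm (P f) = 1 - norm (f - P f)\<close>, estimating both components of
  \<open>f\<close> at \<open>x\<close> gives
  \<open>norm (f - P f) * (1 - infdist x J) \<le> 0\<close>.\<close>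

lemma norm_subdiff_subset_range:
  assumes J: "J \<noteq> {}" and P: "M_ideal_projection J P"
    and x: "norm x = 1" and d: "infdist x J < 1" and f: "f \<in> norm_subdiff x"
  shows "P f = f"
proof -
  have fd: "f \<in> cdual" "norm f = 1" "blinfun_apply f x = 1"
    using f x by (auto simp: norm_subdiff_def)
  have Pf: "P f \<in> cdual" and Pdual: "\<And>f g. f \<in> cdual \<Longrightarrow> g \<in> cdual \<Longrightarrow> P (f + g) = P f + P g"
    and idem: "P (P f) = P f" and ker: "{f \<in> cdual. P f = 0} = annihilator J"
    and nrm: "norm f = norm (P f) + norm (f - P f)"
    using P fd(1) unfolding M_ideal_projection_def by blast+
  \<comment> \<open>By idempotence this says \<open>P (f - P f) = 0\<close>, and the kernel of
    \<open>P\<close> is the annihilator.\<close>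
  have "P f = P (f - P f) + P (P f)"
    using Pdual[OF cdual_diff[OF fd(1) Pf] Pf] by simp
  then have "f - P f \<in> annihilator J"
    using idem cdual_diff[OF fd(1) Pf] by (simp flip: ker)
  then have ann: "norm (blinfun_apply (f - P f) x) \<le> norm (f - P f) * infdist x J"
    using norm_annihilator_le_infdist J by blast
  have "1 = norm (blinfun_apply (P f) x + blinfun_apply (f - P f) x)"
    using fd(3) by (simp add: blinfun.diff_left)
  also have "\<dots> \<le> norm (P f) + norm (f - P f) * infdist x J"
    using norm_triangle_ineq[of "blinfun_apply (P f) x" "blinfun_apply (f - P f) x"]
      norm_blinfun[of "P f" x] ann x by simp
  finally have "norm (f - P f) * (1 - infdist x J) \<le> 0"
    using nrm fd(2) by (simp add: algebra_simps)
  then have "norm (f - P f) \<le> 0" using d by (simp add: mult_le_0_iff)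
  then show ?thesis by simp
qed

text \<open>The closed unit disc touches the line of real part \<open>1\<close> only at
  \<open>1\<close>; arguments about real parts thereby yield complex values.\<close>

lemma complex_eq_1I:
  fixes c :: complex
  assumes "cmod c \<le> 1" "Re c = 1"
  shows "c = 1"
proof -
  have "(Re c)\<^sup>2 + (Im c)\<^sup>2 \<le> 1"
    using assms(1) by (simp add: cmod_def)
  then show ?thesis using assms(2) by (simp add: complex_eq_iff)
qed

text \<open>Members of the ball have real part at most \<open>1\<close> at \<open>x\<close>, so an
  average with positive weights equals \<open>1\<close> only if both values do. The face property
  identifies extreme points of the subdifferential with those of the ball.\<close>

lemma norm_subdiff_face_of_J_dual_ball:
  assumes J: "J \<noteq> {}" and P: "M_ideal_projection J P"
    and x: "norm x = 1" and d: "infdist x J < 1"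
  shows "norm_subdiff x face_of J_dual_ball P"
    and "norm_subdiff x = {f \<in> J_dual_ball P. blinfun_apply f x = 1}"
proof -
  have Pc: "P ` cdual \<subseteq> cdual" using P by (auto simp: M_ideal_projection_def)
  show eq: "norm_subdiff x = {f \<in> J_dual_ball P. blinfun_apply f x = 1}"
  proof (intro equalityI subsetI)
    fix f assume f: "f \<in> norm_subdiff x"
    then have "f = P f" using norm_subdiff_subset_range[OF assms] by simp
    then show "f \<in> {f \<in> J_dual_ball P. blinfun_apply f x = 1}"
      using f by (auto simp: norm_subdiff_unit[OF x] J_dual_ball_def)
  qed (use Pc in \<open>auto simp: norm_subdiff_unit[OF x] J_dual_ball_def\<close>)
  show "norm_subdiff x face_of J_dual_ball P"
    unfolding face_of_def
  proof (intro conjI ballI impI norm_subdiff_compact_convex[OF x])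
    show "norm_subdiff x \<subseteq> J_dual_ball P" by (auto simp: eq)
    fix a b f
    assume ab: "a \<in> J_dual_ball P" "b \<in> J_dual_ball P"
      and f: "f \<in> norm_subdiff x" "f \<in> open_segment a b"
    obtain u where u: "0 < u" "u < 1" "f = (1 - u) *\<^sub>R a + u *\<^sub>R b"
      using f(2) by (auto simp: in_segment)
    have le: "norm (blinfun_apply a x) \<le> 1" "norm (blinfun_apply b x) \<le> 1"
      using ab blinfun_apply_le_norm[of _ x] x by (auto simp: J_dual_ball_def)
    have "(1 - u) * Re (blinfun_apply a x) + u * Re (blinfun_apply b x) = 1"
    proof -
      have "blinfun_apply f x = 1" using f(1) by (simp add: eq)
      then have "Re ((1 - u) *\<^sub>R blinfun_apply a x + u *\<^sub>R blinfun_apply b x) = 1"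
        by (simp add: u(3) blinfun.add_left blinfun.scaleR_left)
      then show ?thesis by simp
    qed
    then have "(1 - u) * (1 - Re (blinfun_apply a x)) + u * (1 - Re (blinfun_apply b x)) = 0"
      by (simp add: algebra_simps)
    moreover have "(1 - u) * (1 - Re (blinfun_apply a x)) \<ge> 0" "u * (1 - Re (blinfun_apply b x)) \<ge> 0"
      using u le complex_Re_le_cmod[of "blinfun_apply a x"] complex_Re_le_cmod[of "blinfun_apply b x"]
      by simp_all
    ultimately have "(1 - u) * (1 - Re (blinfun_apply a x)) = 0" "u * (1 - Re (blinfun_apply b x)) = 0"
      by linarith+
    then have "blinfun_apply a x = 1" "blinfun_apply b x = 1"
      using u le complex_eq_1I by auto
    then show "a \<in> norm_subdiff x" "b \<in> norm_subdiff x" using ab by (auto simp: eq)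
  qed
qed

section \<open>Subgradients from real Hahn-Banach functionals\<close>

lemma complexify_functional:
  fixes g :: "'a::complex_normed_vector \<Rightarrow> real"
  assumes g: "linear g" and le: "\<And>z. g z \<le> norm z"
  obtains f where "f \<in> cdual" "norm f \<le> 1" "\<And>z. Re (blinfun_apply f z) = g z"
proof -
  \<comment> \<open>A complex-linear functional is determined by its real part \<open>g\<close>:
    this is its only possible form.\<close>
  define h where "h z = Complex (g z) (- g (\<i> *\<^sub>C z))" for z
  have add: "h (u + v) = h u + h v" for u v
    by (simp add: h_def scaleC_add_right linear_add[OF g] complex_eq_iff)
  have i: "h (\<i> *\<^sub>C u) = \<i> * h u" for u
    using scaleC_of_real[of "-1" u] linear_neg[OF g, of u]
    by (simp add: h_def scaleC_scaleC complex_eq_iff)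
  have R: "h (complex_of_real r *\<^sub>C u) = complex_of_real r * h u" for r u
  proof -
    have "\<i> *\<^sub>C (r *\<^sub>R u) = r *\<^sub>R (\<i> *\<^sub>C u)"
      by (simp add: scaleC_scaleC mult.commute flip: scaleC_of_real)
    then show ?thesis
      by (simp add: h_def scaleC_of_real linear_scale[OF g] complex_eq_iff)
  qed
  have sc: "h (c *\<^sub>C u) = c * h u" for c u
  proof -
    have "c *\<^sub>C u = complex_of_real (Re c) *\<^sub>C u + \<i> *\<^sub>C (complex_of_real (Im c) *\<^sub>C u)"
      by (subst complex_eq[of c]) (simp only: scaleC_add_left scaleC_scaleC)
    then have "h (c *\<^sub>C u) = (complex_of_real (Re c) + \<i> * complex_of_real (Im c)) * h u"
      by (simp add: add i R algebra_simps)
    then show ?thesis by (simp flip: complex_eq)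
  qed
  have Re_h: "Re (h z) = g z" for z by (simp add: h_def)
  have bound: "norm (h z) \<le> norm z" for z
  proof (cases "h z = 0")
    case False
    \<comment> \<open>A unimodular factor rotating \<open>h z\<close> onto the positive axis;
      \<open>cmod (h z)\<close> becomes a value of \<open>g\<close>, to which \<open>le\<close>
      applies.\<close>
    define c where "c = cnj (sgn (h z))"
    have c: "cmod c = 1" using False by (simp add: c_def norm_sgn)
    have "c * h z = complex_of_real (cmod (h z))"
      using False by (simp add: c_def sgn_eq complex_norm_square[symmetric] power2_eq_square mult.commute)
    then have "cmod (h z) = g (c *\<^sub>C z)"
      using Re_h[of "c *\<^sub>C z"] sc[of c z] by simp
    also have "\<dots> \<le> norm z" using le[of "c *\<^sub>C z"] by (simp add: norm_scaleC c)
    finally show ?thesis .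
  qed simp
  have "h (r *\<^sub>R u) = r *\<^sub>R h u" for r u
    using R[of r u] by (simp add: scaleC_of_real scaleR_conv_of_real)
  then have "bounded_linear h"
    by (intro bounded_linear_intro[where K = 1]) (auto simp: add bound)
  then have h: "blinfun_apply (Blinfun h) = h" by (rule bounded_linear_Blinfun_apply)
  show thesis
  proof
    show "Blinfun h \<in> cdual" by (simp add: cdual_def h sc)
    show "norm (Blinfun h) \<le> 1" by (rule norm_blinfun_bound) (auto simp: h bound)
  qed (simp add: h Re_h)
qed

text \<open>Hahn-Banach is applied to the directional derivative at \<open>x\<close>, which lies
  below the norm and is at most \<open>- 1\<close> at \<open>- x\<close>. The resulting functional
  is therefore bounded by the norm and equals \<open>1\<close> at \<open>x\<close>.\<close>

lemma norm_subdiff_attains_directional_derivative: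
  fixes x :: "'a::complex_normed_vector"
  assumes x: "norm x = 1"
  obtains f where "f \<in> norm_subdiff x" "Re (blinfun_apply f y) = sub_shift norm x y"
proof -
  note sub = sublinear_sub_shift[OF sublinear_norm, of x]
  obtain g where g: "linear g" "\<And>z. g z \<le> sub_shift norm x z" "g y = sub_shift norm x y"
    using hahn_banach_sublinear[OF sub] by blast
  have le: "g z \<le> norm z" for z
    using g(2)[of z] sub_shift_le_self[OF sublinear_norm, of x z] by simp
  obtain f where f: "f \<in> cdual" "norm f \<le> 1" "\<And>z. Re (blinfun_apply f z) = g z"
    using complexify_functional[OF g(1) le] by blast
  have "g (- x) \<le> - 1"
    using g(2)[of "- x"] sub_shift_minus[OF sublinear_norm, of x] x by simp
  then have "Re (blinfun_apply f x) = 1"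
    using le[of x] linear_neg[OF g(1), of x] f(3)[of x] x by simp
  moreover have "norm (blinfun_apply f x) \<le> 1"
    using blinfun_apply_le_norm[OF f(2), of x] x by simp
  ultimately have "blinfun_apply f x = 1"
    by (intro complex_eq_1I)
  then have "f \<in> norm_subdiff x" using f by (simp add: norm_subdiff_unit[OF x])
  then show thesis using that f(3) g(3) by simp
qed

text \<open>As \<open>f\<close> has value \<open>1\<close> at \<open>x\<close>, its real part at
  \<open>y\<close> is that at \<open>y + t *\<^sub>R x\<close> minus \<open>t\<close>, hence below
  each term of the infimum.\<close>

lemma Re_norm_subdiff_le:
  fixes x :: "'a::complex_normed_vector"
  assumes x: "norm x = 1" and f: "f \<in> norm_subdiff x"
  shows "Re (blinfun_apply f y) \<le> sub_shift norm x y"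
proof (rule sub_shift_greatest)
  fix t :: real
  have f: "norm f \<le> 1" "blinfun_apply f x = 1" using f by (auto simp: norm_subdiff_unit[OF x])
  have "Re (blinfun_apply f y) + t = Re (blinfun_apply f (y + t *\<^sub>R x))"
    by (simp add: blinfun.bilinear_simps f)
  also have "\<dots> \<le> norm (y + t *\<^sub>R x)"
    using complex_Re_le_cmod blinfun_apply_le_norm[OF f(1)] order_trans by blast
  finally show "Re (blinfun_apply f y) \<le> norm (y + t *\<^sub>R x) - t * norm x" using x by simp
qed

theorem theorem1:
  fixes J :: "'a::cbanach set"
    and P :: "('a \<Rightarrow>\<^sub>L complex) \<Rightarrow> ('a \<Rightarrow>\<^sub>L complex)"
    and x :: 'a
  assumes "M_ideal J"
    and "M_ideal_projection J P"
    and "norm x = 1"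
    and "infdist x J < 1"
  shows "norm_subdiff x =
      weak_star_topology closure_of
        (convex hull {f. f extreme_point_of J_dual_ball P \<and> blinfun_apply f x = 1})
    \<and> (\<forall>y. ((\<lambda>t. (norm (x + t *\<^sub>R y) - norm x) / t) \<longlongrightarrow>
          (SUP f\<in>{f. f extreme_point_of J_dual_ball P \<and> blinfun_apply f x = 1}.
             Re (blinfun_apply f y))) (at_right 0))"
proof -
  define E where "E = {f. f extreme_point_of J_dual_ball P \<and> blinfun_apply f x = 1}"
  have J: "J \<noteq> {}" using assms(1) by (auto simp: M_ideal_def csubspace_def)
  note face = norm_subdiff_face_of_J_dual_ball[OF J assms(2-4)]
  note K = norm_subdiff_compact_convex[OF assms(3)]
  \<comment> \<open>Extreme points of a face are the extreme points of the ball that lie in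
    it.\<close>
  have E: "E = {f. f extreme_point_of norm_subdiff x}"
    unfolding E_def extreme_point_of_face[OF face(1)]
    by (auto simp: face(2) extreme_point_of_def)
  have sub: "norm_subdiff x \<subseteq> cdual" by (auto simp: norm_subdiff_def)
  have hull: "convex hull E \<subseteq> norm_subdiff x"
    by (rule hull_minimal) (auto simp: E extreme_point_of_def K)
  \<comment> \<open>The weak-star closure is a relative closure in \<open>cdual\<close>; it equals
    the full one since the subdifferential lies in \<open>cdual\<close>.\<close>
  have "weak_star_topology closure_of (convex hull E)
      = cdual \<inter> strong_operator_topology closure_of (cdual \<inter> convex hull E)"
    unfolding weak_star_topology_def by (rule closure_of_subtopology)
  also have "cdual \<inter> convex hull E = convex hull E"
    using order_trans[OF hull sub] by (rule Int_absorb1)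
  also have "strong_operator_topology closure_of (convex hull E) = norm_subdiff x"
    unfolding E by (rule sot.krein_milman[OF K, symmetric])
  also have "cdual \<inter> norm_subdiff x = norm_subdiff x"
    using sub by (rule Int_absorb1)
  finally have eq: "norm_subdiff x = weak_star_topology closure_of (convex hull E)" ..
  have deriv: "((\<lambda>t. (norm (x + t *\<^sub>R y) - norm x) / t) \<longlongrightarrow> (SUP f\<in>E. Re (blinfun_apply f y)))
      (at_right 0)" for y
  proof -
    obtain f where f: "f \<in> norm_subdiff x" "Re (blinfun_apply f y) = sub_shift norm x y"
      using norm_subdiff_attains_directional_derivative[OF assms(3)] by blast
    have lin: "linear (\<lambda>f. Re (blinfun_apply f y))"
      by (rule linearI) (auto simp: blinfun.bilinear_simps)
    have "continuous_map strong_operator_topology euclideanreal (Re \<circ> (\<lambda>f. blinfun_apply f y))"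
      by (rule continuous_map_compose[OF strong_operator_topology_continuous_evaluation])
        (simp only: continuous_map_iff_continuous2, intro continuous_intros)
    then have cont: "continuous_map strong_operator_topology euclideanreal (\<lambda>f. Re (blinfun_apply f y))"
      by (simp only: o_def)
    have "norm_subdiff x \<noteq> {}" using f(1) by blast
    then obtain e where e: "e extreme_point_of norm_subdiff x"
      "\<And>f. f \<in> norm_subdiff x \<Longrightarrow> Re (blinfun_apply f y) \<le> Re (blinfun_apply e y)"
      using sot.extreme_point_maximizes[OF K _ lin cont] by blast
    have le: "Re (blinfun_apply h y) \<le> sub_shift norm x y" if "h \<in> E" for h
      using Re_norm_subdiff_le[OF assms(3)] that by (simp add: E extreme_point_of_def)
    have "e \<in> E" using e(1) by (simp add: E)
    \<comment> \<open>The extreme point \<open>e\<close> does at least as well as the subgradient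
      \<open>f\<close> attaining the derivative, and \<open>le\<close> bounds it from above. So the
      supremum is a maximum.\<close>
    then have "sub_shift norm x y \<in> (\<lambda>f. Re (blinfun_apply f y)) ` E"
      using e(2)[OF f(1)] f(2) le[of e] by force
    then have "(SUP f\<in>E. Re (blinfun_apply f y)) = sub_shift norm x y"
      by (rule cSup_eq_maximum) (use le in auto)
    then show ?thesis using norm_directional_derivative[of x y] by simp
  qed
  show ?thesis
    unfolding E_def[symmetric] by (intro conjI allI eq deriv)
qed

end
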